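(* Let $n,m\ge3$ be odd integers, $S$ and $T$ 2-partitions of $\mathbb{Z}_n^*$ and $\mathbb{Z}_m^*$ respectively, and $X_m$ a nucleus of order $m$, and let $W^X_{ST}$ be an $X$-generated product. Then $W^X_{ST}$ is a strong 2-partition of $\mathbb{Z}_{mn}^*$ if and only if $X_m$ is skew in $\mathbb{Z}_m$, $S$ is strong and $T$ is strong. Likewise, $W^X_{ST}$ is a skew 2-partition of $\mathbb{Z}_{mn}^*$ if and only if $X_m$ is skew in $\mathbb{Z}_m$, $S$ is skew and $T$ is skew.
   Context: $\mathbb{Z}_k^*=\mathbb{Z}_k\setminus\{0\}$; a 2-partition of $\mathbb{Z}_k^*$ ($k$ odd) is a partition into unordered pairs $\{x_i,y_i\}$. It is strong if the sums $x_i+y_i\bmod k$ are all nonzero and pairwise distinct; skew if $\{\pm(x_i+y_i)\bmod k\}=\mathbb{Z}_k^*$. A nucleus of order $m$ is a set of ordered pairs $X_m=\{(u_i,v_i)\}_{i=1}^{m-1}\subset\mathbb{Z}_m^*\times\mathbb{Z}_m^*$ with $\{u_i\}=\{v_i\}=\mathbb{Z}_m^*$; it is skew if $\{(u_i+v_i)\bmod m: 1\le i\le m-1\}=\mathbb{Z}_m^*$. $X$-generated product: with $n=2q+1$, $m=2p+1$, let $\tilde S$ (resp. $\tilde T$) be any set of ordered pairs obtained by ordering each pair of $S$ (resp. $T$) in either way. $W^X_{ST}$ consists of the unordered pairs $\{nr+x,\ nt+y\}$ (mod $nm$, with $x,y$ represented in $\{0,\dots,n-1\}$) of two types: (i$_X$)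 one pair for each $(x,y)\in\tilde S$ and each $(r,t)\in\{(0,0)\}\cup X_m$; (ii$_X$) one pair for each $(r,t)\in\tilde T$ with $x=y=0$. *)

theory Defs
  imports Main "HOL-Library.Disjoint_Sets"
begin

text \<open>Residues modulo \<open>k\<close> are represented by the integers \<open>0, \<dots>, k - 1\<close>.\<close>

definition Zstar :: "int \<Rightarrow> int set" where
  "Zstar k = {0..<k} - {0}"

definition two_partition :: "int \<Rightarrow> int set set \<Rightarrow> bool" where
  "two_partition k P \<longleftrightarrow> partition_on (Zstar k) P \<and> (\<forall>p\<in>P. card p = 2)"

text \<open>An unordered pair is a two-element set, so \<open>pair_sum k {x, y} = (x + y) mod k\<close>
  for \<open>x \<noteq> y\<close>.\<close>

definition pair_sum :: "int \<Rightarrow> int set \<Rightarrow> int" where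
  "pair_sum k p = (\<Sum>z\<in>p. z) mod k"

definition strong_two_partition :: "int \<Rightarrow> int set set \<Rightarrow> bool" where
  "strong_two_partition k P \<longleftrightarrow>
     two_partition k P \<and> (\<forall>p\<in>P. pair_sum k p \<noteq> 0) \<and> inj_on (pair_sum k) P"

definition skew_two_partition :: "int \<Rightarrow> int set set \<Rightarrow> bool" where
  "skew_two_partition k P \<longleftrightarrow>
     two_partition k P \<and> (\<Union>p\<in>P. {pair_sum k p, (- pair_sum k p) mod k}) = Zstar k"

definition nucleus :: "int \<Rightarrow> (int \<times> int) set \<Rightarrow> bool" where
  "nucleus m X \<longleftrightarrow>
     X \<subseteq> Zstar m \<times> Zstar m \<and> int (card X) = m - 1 \<and> fst ` X = Zstar m \<and> snd ` X = Zstar m"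

definition skew_nucleus :: "int \<Rightarrow> (int \<times> int) set \<Rightarrow> bool" where
  "skew_nucleus m X \<longleftrightarrow> nucleus m X \<and> (\<lambda>(u, v). (u + v) mod m) ` X = Zstar m"

text \<open>\<open>Q\<close> arises from the set \<open>P\<close> of unordered pairs by ordering each pair in one of the two ways;
  injectivity excludes having both orders of the same pair in \<open>Q\<close>.\<close>

definition ordering_of :: "int set set \<Rightarrow> (int \<times> int) set \<Rightarrow> bool" where
  "ordering_of P Q \<longleftrightarrow> bij_betw (\<lambda>(x, y). {x, y}) Q P"

definition product_pairs ::
  "int \<Rightarrow> int \<Rightarrow> (int \<times> int) set \<Rightarrow> (int \<times> int) set \<Rightarrow> (int \<times> int) set \<Rightarrow> int set set" where
  "product_pairs n m X S' T' =
     {{(n * r + x) mod (n * m), (n * t + y) mod (n * m)} | x y r t.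
        (x, y) \<in> S' \<and> (r, t) \<in> {(0, 0)} \<union> X} \<union>
     {{(n * r) mod (n * m), (n * t) mod (n * m)} | r t. (r, t) \<in> T'}"

definition generated_product ::
  "int \<Rightarrow> int \<Rightarrow> (int \<times> int) set \<Rightarrow> int set set \<Rightarrow> int set set \<Rightarrow> int set set \<Rightarrow> bool" where
  "generated_product n m X S T W \<longleftrightarrow>
     (\<exists>S' T'. ordering_of S S' \<and> ordering_of T T' \<and> W = product_pairs n m X S' T')"

end

theory Submission
  imports Defs
begin

text \<open>The sum of a pair of type (i) is \<open>n (r + t) + (x + y)\<close>, so its residue modulo \<open>n\<close> only
  depends on the pair of \<open>S\<close>, and for a fixed pair of \<open>S\<close> the sums are distinct iff the sums
  \<open>r + t\<close> over \<open>{(0, 0)} \<union> X\<close> are distinct modulo \<open>m\<close>, i.e. iff \<open>X\<close> is skew. If \<open>X\<close> is skew,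
  every pair of \<open>S\<close> uses up its whole residue class modulo \<open>n\<close>, which forces \<open>S\<close> to be strong
  when the product is. The pairs of type (ii) carry the multiples of \<open>n\<close> and reproduce \<open>T\<close>.
  For the skew case, counting shows that a skew 2-partition is strong.\<close>

section \<open>2-partitions as sets of ordered pairs\<close>

text \<open>Order matters because the two entries of a pair receive the two components of a nucleus
  pair. The last two clauses together keep \<open>(x, y)\<close> and \<open>(y, x)\<close> from both
  lying in \<open>Q\<close>: they would meet, forcing \<open>x = y\<close>.\<close>

definition ordered_two_partition :: "int \<Rightarrow> (int \<times> int) set \<Rightarrow> bool" where
  "ordered_two_partition k Q \<longleftrightarrow>
     Q \<subseteq> Zstar k \<times> Zstar k \<and>
     (\<forall>z\<in>Zstar k. \<exists>x y. (x, y) \<in> Q \<and> z \<in> {x, y}) \<and>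
     (\<forall>x y. (x, y) \<in> Q \<longrightarrow> x \<noteq> y) \<and>
     (\<forall>x y x' y'. (x, y) \<in> Q \<longrightarrow> (x', y') \<in> Q \<longrightarrow> {x, y} \<inter> {x', y'} \<noteq> {} \<longrightarrow> x = x' \<and> y = y')"

text \<open>Entries are left unreduced so that they can be compared as integers through their base
  \<open>n\<close> digits.\<close>

definition product_ordering ::
  "int \<Rightarrow> (int \<times> int) set \<Rightarrow> (int \<times> int) set \<Rightarrow> (int \<times> int) set \<Rightarrow> (int \<times> int) set" where
  "product_ordering n X S' T' =
     {(n * r + x, n * t + y) | x y r t. (x, y) \<in> S' \<and> (r, t) \<in> insert (0, 0) X} \<union>
     {(n * r, n * t) | r t. (r, t) \<in> T'}"

lemma mem_Zstar: "z \<in> Zstar k \<longleftrightarrow> 0 < z \<and> z < k"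
  by (auto simp: Zstar_def)

lemma mod_mem_Zstar: "k > 0 \<Longrightarrow> a mod k \<in> Zstar k \<longleftrightarrow> a mod k \<noteq> 0"
  by (auto simp: Zstar_def)

lemma card_Zstar: "k \<ge> 1 \<Longrightarrow> int (card (Zstar k)) = k - 1"
  by (simp add: Zstar_def card_Diff_singleton)

lemma finite_Zstar: "finite (Zstar k)"
  by (simp add: Zstar_def)

text \<open>Disjointness of \<open>P\<close> makes meeting pairs equal as sets; injectivity of the
  ordering then makes them equal as ordered pairs.\<close>

lemma ordered_two_partition_of_ordering:
  assumes P: "two_partition k P" and Q: "ordering_of P Q"
  shows "ordered_two_partition k Q"
proof -
  have inj: "inj_on (\<lambda>(x, y). {x, y}) Q" and img: "(\<lambda>(x, y). {x, y}) ` Q = P"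
    using Q by (auto simp: ordering_of_def bij_betw_def)
  have U: "\<Union>P = Zstar k" and D: "disjoint P" and c: "\<And>p. p \<in> P \<Longrightarrow> card p = 2"
    using P by (auto simp: two_partition_def partition_on_def)
  have mem: "{x, y} \<in> P" if "(x, y) \<in> Q" for x y
    using img that by force
  have sub: "Q \<subseteq> Zstar k \<times> Zstar k"
    using mem U by auto
  have cov: "\<exists>x y. (x, y) \<in> Q \<and> z \<in> {x, y}" if "z \<in> Zstar k" for z
  proof -
    obtain p where "p \<in> (\<lambda>(x, y). {x, y}) ` Q" "z \<in> p"
      using \<open>z \<in> Zstar k\<close> unfolding U[symmetric] img by (rule UnionE)
    then show ?thesis
      by (fastforce simp: case_prod_unfold)
  qed
  have ne: "x \<noteq> y" if "(x, y) \<in> Q" for x y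
    using c[OF mem[OF that]] by auto
  have "x = x' \<and> y = y'"
    if "(x, y) \<in> Q" "(x', y') \<in> Q" "{x, y} \<inter> {x', y'} \<noteq> {}" for x y x' y'
  proof -
    have "{x, y} = {x', y'}"
      using D mem that by (meson disjointD)
    then show ?thesis
      using inj_onD[OF inj, of "(x, y)" "(x', y')"] that by simp
  qed
  then show ?thesis
    unfolding ordered_two_partition_def using sub cov ne by blast
qed

lemma
  assumes Q: "ordered_two_partition k Q" and P: "P = (\<lambda>(x, y). {x, y}) ` Q"
  shows two_partition_of_ordered: "two_partition k P"
    and ordering_of_ordered: "ordering_of P Q"
proof -
  have sub: "Q \<subseteq> Zstar k \<times> Zstar k"
    and cov: "\<And>z. z \<in> Zstar k \<Longrightarrow> \<exists>x y. (x, y) \<in> Q \<and> z \<in> {x, y}"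
    and ne: "\<And>x y. (x, y) \<in> Q \<Longrightarrow> x \<noteq> y"
    and dis: "\<And>x y x' y'. (x, y) \<in> Q \<Longrightarrow> (x', y') \<in> Q \<Longrightarrow> {x, y} \<inter> {x', y'} \<noteq> {} \<Longrightarrow>
      x = x' \<and> y = y'"
    using Q unfolding ordered_two_partition_def by blast+
  have "\<Union>P \<subseteq> Zstar k"
    using sub by (auto simp: P)
  moreover have "Zstar k \<subseteq> \<Union>P"
    using cov by (fastforce simp: P)
  moreover have "disjoint P"
    unfolding P
  proof (rule disjointI)
    fix p q
    assume "p \<in> (\<lambda>(x, y). {x, y}) ` Q" "q \<in> (\<lambda>(x, y). {x, y}) ` Q" "p \<noteq> q"
    then obtain x y x' y' where "p = {x, y}" "(x, y) \<in> Q" "q = {x', y'}" "(x', y') \<in> Q"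
      by auto
    with dis \<open>p \<noteq> q\<close> show "p \<inter> q = {}"
      by blast
  qed
  moreover have "card p = 2" if "p \<in> P" for p
    using that ne by (auto simp: P)
  moreover have "{} \<notin> P"
    by (auto simp: P)
  ultimately show "two_partition k P"
    unfolding two_partition_def partition_on_def by blast
  have "inj_on (\<lambda>(x, y). {x, y}) Q"
  proof (rule inj_onI)
    fix a b
    assume "a \<in> Q" "b \<in> Q" "(\<lambda>(x, y). {x, y}) a = (\<lambda>(x, y). {x, y}) b"
    then show "a = b"
      using dis[of "fst a" "snd a" "fst b" "snd b"] by (auto simp: case_prod_unfold prod_eq_iff)
  qed
  then show "ordering_of P Q"
    by (simp add: ordering_of_def bij_betw_def P)
qed

lemma strong_two_partition_iff_ordered:
  assumes P: "two_partition k P" and Q: "ordering_of P Q"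
  shows "strong_two_partition k P \<longleftrightarrow>
    (\<forall>x y. (x, y) \<in> Q \<longrightarrow> (x + y) mod k \<noteq> 0) \<and>
    (\<forall>x y x' y'. (x, y) \<in> Q \<longrightarrow> (x', y') \<in> Q \<longrightarrow> (x + y) mod k = (x' + y') mod k \<longrightarrow>
      x = x' \<and> y = y')"
proof -
  have inj: "inj_on (\<lambda>(x, y). {x, y}) Q" and img: "P = (\<lambda>(x, y). {x, y}) ` Q"
    using Q by (auto simp: ordering_of_def bij_betw_def)
  have ne: "\<And>x y. (x, y) \<in> Q \<Longrightarrow> x \<noteq> y"
    using ordered_two_partition_of_ordering[OF P Q] unfolding ordered_two_partition_def by blast
  \<comment> \<open>\<open>pair_sum\<close> adds up a set, where equal entries would count once;
    hence the appeal to \<open>ne\<close>.\<close>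
  have sum: "pair_sum k {x, y} = (x + y) mod k" if "(x, y) \<in> Q" for x y
    using ne[OF that] by (simp add: pair_sum_def)
  have "inj_on (pair_sum k) P \<longleftrightarrow> inj_on (pair_sum k \<circ> (\<lambda>(x, y). {x, y})) Q"
    unfolding img using comp_inj_on_iff[OF inj] by simp
  also have "\<dots> \<longleftrightarrow> inj_on (\<lambda>(x, y). (x + y) mod k) Q"
    by (rule inj_on_cong) (auto simp: sum)
  also have "\<dots> \<longleftrightarrow>
    (\<forall>x y x' y'. (x, y) \<in> Q \<longrightarrow> (x', y') \<in> Q \<longrightarrow> (x + y) mod k = (x' + y') mod k \<longrightarrow>
      x = x' \<and> y = y')"
    unfolding inj_on_def by auto
  finally have inj_iff: "inj_on (pair_sum k) P \<longleftrightarrow> \<dots>" .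
  have nonzero_iff:
    "(\<forall>p\<in>P. pair_sum k p \<noteq> 0) \<longleftrightarrow> (\<forall>x y. (x, y) \<in> Q \<longrightarrow> (x + y) mod k \<noteq> 0)"
    unfolding img by (auto simp: sum)
  show ?thesis
    unfolding strong_two_partition_def inj_iff nonzero_iff by (simp only: P simp_thms)
qed

text \<open>Equality with \<open>Zstar k\<close> splits into two inclusions: one says that no sum
  vanishes, a condition shared with strongness, and the other is the covering condition.\<close>

lemma skew_two_partition_iff_ordered:
  assumes P: "two_partition k P" and Q: "ordering_of P Q" and k: "k > 0"
  shows "skew_two_partition k P \<longleftrightarrow>
    (\<forall>x y. (x, y) \<in> Q \<longrightarrow> (x + y) mod k \<noteq> 0) \<and>
    (\<forall>z\<in>Zstar k. \<exists>x y. (x, y) \<in> Q \<and> (z = (x + y) mod k \<or> z = - (x + y) mod k))"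
proof -
  have img: "P = (\<lambda>(x, y). {x, y}) ` Q"
    using Q by (auto simp: ordering_of_def bij_betw_def)
  have ne: "\<And>x y. (x, y) \<in> Q \<Longrightarrow> x \<noteq> y"
    using ordered_two_partition_of_ordering[OF P Q] unfolding ordered_two_partition_def by blast
  have sum: "pair_sum k {x, y} = (x + y) mod k" if "(x, y) \<in> Q" for x y
    using ne[OF that] by (simp add: pair_sum_def)
  have "(\<Union>p\<in>P. {pair_sum k p, (- pair_sum k p) mod k}) =
      (\<Union>(x, y)\<in>Q. {(x + y) mod k, (- ((x + y) mod k)) mod k})"
    unfolding img using sum by fastforce
  also have "\<dots> = (\<Union>(x, y)\<in>Q. {(x + y) mod k, - (x + y) mod k})"
    by (simp only: mod_minus_eq)
  finally have U: "(\<Union>p\<in>P. {pair_sum k p, (- pair_sum k p) mod k}) = \<dots>" .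
  have "{a mod k, - a mod k} \<subseteq> Zstar k \<longleftrightarrow> a mod k \<noteq> 0" for a
    using mod_mem_Zstar[OF k] by (auto simp: mod_eq_0_iff_dvd)
  then have "(\<Union>(x, y)\<in>Q. {(x + y) mod k, - (x + y) mod k}) \<subseteq> Zstar k \<longleftrightarrow>
      (\<forall>x y. (x, y) \<in> Q \<longrightarrow> (x + y) mod k \<noteq> 0)"
    by (simp only: UN_subset_iff Ball_def split_paired_All case_prod_conv)
  moreover have "Zstar k \<subseteq> (\<Union>(x, y)\<in>Q. {(x + y) mod k, - (x + y) mod k}) \<longleftrightarrow>
      (\<forall>z\<in>Zstar k. \<exists>x y. (x, y) \<in> Q \<and> (z = (x + y) mod k \<or> z = - (x + y) mod k))"
    by (force simp del: minus_add_distrib)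
  ultimately show ?thesis
    unfolding skew_two_partition_def U set_eq_subset by (simp only: P simp_thms)
qed

section \<open>Counting: skew 2-partitions are strong\<close>

lemma card_two_partition:
  assumes "two_partition k P" "k \<ge> 1"
  shows "2 * int (card P) = k - 1"
proof -
  have "card (Zstar k) = (\<Sum>p\<in>P. card p)"
    using assms product_partition[of "Zstar k" P] finite_Zstar
    by (auto simp: two_partition_def partition_on_def intro: finite_subset)
  also have "\<dots> = 2 * card P"
    using assms by (simp add: two_partition_def)
  finally show ?thesis
    using card_Zstar[OF assms(2)] by simp
qed

text \<open>There are \<open>(k - 1) / 2\<close> pairs, and each covers at most two of the
  \<open>k - 1\<close> residues. If two pairs had the same sum, one could be dropped and the rest
  would be too few to cover.\<close>

lemma strong_if_skew_two_partition:
  assumes "skew_two_partition k P" "k \<ge> 1"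
  shows "strong_two_partition k P"
proof -
  let ?B = "\<lambda>p. {pair_sum k p, (- pair_sum k p) mod k}"
  have P: "two_partition k P" and U: "(\<Union>p\<in>P. ?B p) = Zstar k"
    using assms by (auto simp: skew_two_partition_def)
  have fin: "finite P"
    using P finite_elements[OF finite_Zstar] by (auto simp: two_partition_def)
  have "inj_on (pair_sum k) P"
  proof (rule inj_onI, rule ccontr)
    fix p q
    assume pq: "p \<in> P" "q \<in> P" "pair_sum k p = pair_sum k q" "p \<noteq> q"
    \<comment> \<open>The block of \<open>q\<close> is still supplied by \<open>p\<close>, so
      removing \<open>q\<close> leaves the union unchanged.\<close>
    then have "?B q = ?B p" "p \<in> P - {q}"
      by auto
    then have "?B q \<subseteq> (\<Union>p\<in>P - {q}. ?B p)"
      by blast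
    then have "(\<Union>p\<in>P - {q}. ?B p) = (\<Union>p\<in>insert q (P - {q}). ?B p)"
      by (simp only: UN_insert sup.absorb2)
    also have "\<dots> = Zstar k"
      by (simp only: insert_Diff[OF pq(2)] U)
    finally have cov: "(\<Union>p\<in>P - {q}. ?B p) = Zstar k" .
    have "card (Zstar k) \<le> (\<Sum>p\<in>P - {q}. card (?B p))"
      unfolding cov[symmetric] using fin by (intro card_UN_le) simp
    also have "\<dots> \<le> (\<Sum>p\<in>P - {q}. 2)"
      by (rule sum_mono) (auto simp: card_insert_if)
    also have "\<dots> < 2 * card P"
      using card_Diff1_less[OF fin pq(2)] by simp
    finally show False
      using card_two_partition[OF P assms(2)] card_Zstar[OF assms(2)] by linarith
  qed
  moreover have "pair_sum k p \<noteq> 0" if "p \<in> P" for p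
    using U that by (force simp: mem_Zstar)
  ultimately show ?thesis
    using P by (simp add: strong_two_partition_def)
qed

section \<open>Nuclei, completed by the pair \<open>(0, 0)\<close>\<close>

lemma nucleus_sub:
  assumes "nucleus m X" "m \<ge> 1" "(r, t) \<in> insert (0, 0) X"
  shows "0 \<le> r" "r < m" "0 \<le> t" "t < m"
  using assms by (auto simp: nucleus_def mem_Zstar)

lemma finite_nucleus: "nucleus m X \<Longrightarrow> finite X"
  using finite_subset[OF _ finite_cartesian_product[OF finite_Zstar finite_Zstar]]
  by (auto simp: nucleus_def)

text \<open>Both projections map \<open>X\<close> onto a set of the same finite size, so they are
  injective; \<open>(0, 0)\<close> may be added since 0 is outside \<open>Zstar m\<close>. With
  surjectivity, \<open>insert (0, 0) X\<close> is the graph of a permutation of the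
  residues.\<close>

lemma nucleus_inj:
  assumes "nucleus m X" "m \<ge> 1" "(r, t) \<in> insert (0, 0) X" "(r', t') \<in> insert (0, 0) X"
  shows "r = r' \<longleftrightarrow> t = t'"
proof -
  have X: "X \<subseteq> Zstar m \<times> Zstar m" "card X = card (Zstar m)" "fst ` X = Zstar m" "snd ` X = Zstar m"
    using assms(1) card_Zstar[OF assms(2)] by (auto simp: nucleus_def)
  have "inj_on fst X" "inj_on snd X"
    using X finite_nucleus[OF assms(1)] by (auto intro!: eq_card_imp_inj_on)
  then have "inj_on fst (insert (0, 0) X)" "inj_on snd (insert (0, 0) X)"
    using X by (auto simp: mem_Zstar)
  then show ?thesis
    using assms(3,4) by (metis fst_conv inj_onD snd_conv)
qed

lemma nucleus_surj:
  assumes "nucleus m X" "0 \<le> i" "i < m"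
  shows "\<exists>t. (i, t) \<in> insert (0, 0) X" "\<exists>r. (r, i) \<in> insert (0, 0) X"
proof -
  have "i = 0 \<or> i \<in> fst ` X" "i = 0 \<or> i \<in> snd ` X"
    using assms by (auto simp: nucleus_def mem_Zstar)
  then show "\<exists>t. (i, t) \<in> insert (0, 0) X" "\<exists>r. (r, i) \<in> insert (0, 0) X"
    by auto
qed

text \<open>As \<open>X\<close> and \<open>Zstar m\<close> have equal size, filling
  \<open>Zstar m\<close> with sums means that the sums are distinct and avoid 0. Adding
  \<open>(0, 0)\<close>, whose sum is 0, merges these two conditions into one.\<close>

lemma skew_nucleus_iff:
  assumes X: "nucleus m X" and m: "m \<ge> 1"
  shows "skew_nucleus m X \<longleftrightarrow> inj_on (\<lambda>(r, t). (r + t) mod m) (insert (0, 0) X)"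
proof -
  let ?f = "\<lambda>(r, t). (r + t) mod m"
  have fin: "finite X" and card: "card X = card (Zstar m)" and sub: "X \<subseteq> Zstar m \<times> Zstar m"
    using finite_nucleus[OF X] X card_Zstar[OF m] by (auto simp: nucleus_def)
  have nin: "(0, 0) \<notin> X"
    using sub by (auto simp: mem_Zstar)
  show ?thesis
  proof
    assume "skew_nucleus m X"
    then have im: "?f ` X = Zstar m"
      by (simp add: skew_nucleus_def)
    then have "inj_on ?f X"
      using fin card by (intro eq_card_imp_inj_on) auto
    moreover have "0 \<notin> ?f ` X"
      unfolding im by (simp add: mem_Zstar)
    ultimately show "inj_on ?f (insert (0, 0) X)"
      using nin by simp
  next
    assume inj: "inj_on ?f (insert (0, 0) X)"
    have "0 \<notin> ?f ` X"
      using inj nin by simp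
    then have "?f p \<noteq> 0" if "p \<in> X" for p
      using that by force
    then have "?f ` X \<subseteq> Zstar m"
      using m mod_mem_Zstar[of m] by fastforce
    moreover have "card (?f ` X) = card (Zstar m)"
      using inj card by (simp add: card_image)
    ultimately have "?f ` X = Zstar m"
      using finite_Zstar by (intro card_subset_eq) auto
    then show "skew_nucleus m X"
      using X by (simp add: skew_nucleus_def)
  qed
qed

text \<open>Residue 0 comes from \<open>(0, 0)\<close>, every other residue from
  \<open>X\<close>.\<close>

lemma skew_nucleus_surj:
  assumes "skew_nucleus m X" "m \<ge> 1"
  obtains r t where "(r, t) \<in> insert (0, 0) X" "(r + t) mod m = c mod m"
proof (cases "c mod m = 0")
  case True
  then show ?thesis
    using that[of 0 0] by simp
next
  case False
  then have "c mod m \<in> Zstar m"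
    using assms(2) by (simp add: mod_mem_Zstar)
  then have "c mod m \<in> (\<lambda>(u, v). (u + v) mod m) ` X"
    using assms(1) by (simp add: skew_nucleus_def)
  then obtain r t where "(r, t) \<in> X" "c mod m = (r + t) mod m"
    by auto
  then show ?thesis
    using that[of r t] by simp
qed

section \<open>Base \<open>n\<close> digits\<close>

lemma digits_unique:
  fixes n :: int
  assumes "n * r + x = n * r' + x'" "0 \<le> x" "x < n" "0 \<le> x'" "x' < n"
  shows "r = r' \<and> x = x'"
proof -
  have "x = x'"
    using arg_cong[OF assms(1), of "\<lambda>a. a mod n"] assms(2-) by simp
  then show ?thesis
    using assms by simp
qed

lemma digits_range:
  fixes n :: int
  assumes "0 \<le> r" "r < m" "0 \<le> x" "x < n"
  shows "0 \<le> n * r + x" "n * r + x < n * m"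
proof -
  show "0 \<le> n * r + x"
    using assms by simp
  \<comment> \<open>Since \<open>r + 1 \<le> m\<close>, a full block of length \<open>n\<close>
    starting at \<open>n * r\<close> still fits below \<open>n * m\<close>.\<close>
  have "n * (r + 1) \<le> n * m"
    using assms by (intro mult_left_mono) auto
  then show "n * r + x < n * m"
    using assms by (simp add: algebra_simps)
qed

section \<open>The generated product is a 2-partition\<close>

context
  fixes n m :: int and X S' T' :: "(int \<times> int) set"
  assumes n: "n \<ge> 3" and m: "m \<ge> 3"
    and X: "nucleus m X"
    and S': "ordered_two_partition n S'" and T': "ordered_two_partition m T'"
begin

text \<open>This rule drives the later case splits and packages the digit bounds. Both low digits of
  a \<open>block\<close> pair are nonzero; both entries of an \<open>axis\<close> pair are multiples
  of \<open>n\<close>.\<close>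

lemma product_pair_cases:
  assumes "(a, b) \<in> product_ordering n X S' T'"
  obtains (block) x y r t where "(x, y) \<in> S'" "(r, t) \<in> insert (0, 0) X"
      "a = n * r + x" "b = n * t + y"
      "0 < x" "x < n" "0 < y" "y < n" "x \<noteq> y" "0 \<le> r" "r < m" "0 \<le> t" "t < m"
  | (axis) r t where "(r, t) \<in> T'" "a = n * r" "b = n * t"
      "0 < r" "r < m" "0 < t" "t < m" "r \<noteq> t"
proof -
  consider x y r t where "(x, y) \<in> S'" "(r, t) \<in> insert (0, 0) X"
      "a = n * r + x" "b = n * t + y"
    | r t where "(r, t) \<in> T'" "a = n * r" "b = n * t"
    using assms unfolding product_ordering_def by blast
  then show thesis
  proof cases
    case 1
    moreover have "x \<in> Zstar n" "y \<in> Zstar n" "x \<noteq> y"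
      using S' 1(1) unfolding ordered_two_partition_def by blast+
    moreover have "0 \<le> r" "r < m" "0 \<le> t" "t < m"
      using nucleus_sub[OF X _ 1(2)] m by auto
    ultimately show thesis
      using block[of x y r t] by (simp add: mem_Zstar)
  next
    case 2
    moreover have "r \<in> Zstar m" "t \<in> Zstar m" "r \<noteq> t"
      using T' 2(1) unfolding ordered_two_partition_def by blast+
    ultimately show thesis
      using axis[of r t] by (simp add: mem_Zstar)
  qed
qed

lemma block_mem:
  "(x, y) \<in> S' \<Longrightarrow> (r, t) \<in> insert (0, 0) X \<Longrightarrow>
    (n * r + x, n * t + y) \<in> product_ordering n X S' T'"
  unfolding product_ordering_def by blast

lemma axis_mem: "(r, t) \<in> T' \<Longrightarrow> (n * r, n * t) \<in> product_ordering n X S' T'"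
  unfolding product_ordering_def by blast

lemma product_pair_range:
  assumes "(a, b) \<in> product_ordering n X S' T'"
  shows "a \<in> Zstar (n * m)" "b \<in> Zstar (n * m)" "a \<noteq> b"
proof -
  have "a \<in> Zstar (n * m) \<and> b \<in> Zstar (n * m) \<and> a \<noteq> b"
    using assms
  proof (cases rule: product_pair_cases)
    case (block x y r t)
    have "a \<noteq> b"
      using digits_unique[of n r x t y] block by auto
    moreover have "0 \<le> n * r" "0 \<le> n * t"
      using block n by auto
    then have "0 < a" "0 < b"
      using block by linarith+
    ultimately show ?thesis
      using digits_range[of r m x n] digits_range[of t m y n] block by (auto simp: mem_Zstar)
  next
    case (axis r t)
    then show ?thesis
      using n by (auto simp: mem_Zstar)
  qed
  then show "a \<in> Zstar (n * m)" "b \<in> Zstar (n * m)" "a \<noteq> b"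
    by auto
qed

text \<open>The low digit \<open>z mod n\<close> selects a pair of \<open>S'\<close>, and the high
  digit \<open>z div n\<close> then selects a nucleus pair. If the low digit is 0, the high digit
  selects a pair of \<open>T'\<close> instead.\<close>

lemma product_cover:
  assumes z: "z \<in> Zstar (n * m)"
  shows "\<exists>a b. (a, b) \<in> product_ordering n X S' T' \<and> z \<in> {a, b}"
proof -
  have eq: "n * (z div n) + z mod n = z"
    by simp
  have "n * (z div n) < n * m"
    using z n eq pos_mod_sign[of n z] by (simp only: mem_Zstar) linarith
  then have rng: "0 \<le> z div n" "z div n < m"
    using z n by (auto simp: mem_Zstar pos_imp_zdiv_nonneg_iff)
  show ?thesis
  proof (cases "z mod n = 0")
    case True
    then have "z = n * (z div n)"
      using eq by linarith
    then have "z div n \<noteq> 0"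
      using z by (auto simp: mem_Zstar)
    then have "z div n \<in> Zstar m"
      using rng by (simp add: mem_Zstar)
    then obtain r t where "(r, t) \<in> T'" "z div n \<in> {r, t}"
      using T' unfolding ordered_two_partition_def by blast
    with axis_mem[OF this(1)] \<open>z = n * (z div n)\<close> show ?thesis
      by (intro exI[of _ "n * r"] exI[of _ "n * t"]) auto
  next
    case False
    then have "z mod n \<in> Zstar n"
      using n by (simp add: mod_mem_Zstar)
    then obtain x y where xy: "(x, y) \<in> S'" "z mod n \<in> {x, y}"
      using S' unfolding ordered_two_partition_def by blast
    \<comment> \<open>Either entry of \<open>(x, y)\<close> may be the low digit of
      \<open>z\<close>, so a nucleus pair is prepared for each position.\<close>
    obtain t r where "(z div n, t) \<in> insert (0, 0) X" "(r, z div n) \<in> insert (0, 0) X"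
      using nucleus_surj[OF X rng] by blast
    from block_mem[OF xy(1) this(1)] block_mem[OF xy(1) this(2)] xy(2) eq show ?thesis
      by (metis insert_iff singletonD)
  qed
qed

text \<open>A common entry fixes a low and a high digit. The low digit determines the pair of
  \<open>S'\<close>, and the high digit the nucleus pair, by injectivity of the projections. Pairs
  of different types never meet, as their low digits differ.\<close>

lemma product_disjoint:
  assumes "(a, b) \<in> product_ordering n X S' T'" "(a', b') \<in> product_ordering n X S' T'"
    and meet: "{a, b} \<inter> {a', b'} \<noteq> {}"
  shows "a = a' \<and> b = b'"
  using assms(1)
proof (cases rule: product_pair_cases)
  case 1: (block x y r t)
  from assms(2) show ?thesis
  proof (cases rule: product_pair_cases)
    case 2: (block x' y' r' t')
    have "n * r + x = n * r' + x' \<or> n * r + x = n * t' + y' \<or>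
        n * t + y = n * r' + x' \<or> n * t + y = n * t' + y'"
      using meet unfolding 1 2 by auto
    then have d: "r = r' \<and> x = x' \<or> r = t' \<and> x = y' \<or> t = r' \<and> y = x' \<or> t = t' \<and> y = y'"
      using digits_unique[of n] 1 2 by (smt (verit))
    then have "{x, y} \<inter> {x', y'} \<noteq> {}"
      by auto
    then have "x = x' \<and> y = y'"
      using S' 1(1) 2(1) unfolding ordered_two_partition_def by blast
    \<comment> \<open>The crossed matches in \<open>d\<close> would give \<open>x = y\<close>, so
      the common entry stands in the same position in both pairs.\<close>
    with d 1(9) 2(9) nucleus_inj[OF X _ 1(2) 2(2)] m show ?thesis
      unfolding 1 2 by auto
  next
    case 2: (axis r' t')
    \<comment> \<open>The added 0 displays the low digit of a multiple of \<open>n\<close>, so that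
      \<open>digits_unique\<close> applies and contradicts \<open>0 < x\<close> and
      \<open>0 < y\<close>.\<close>
    have "n * r + x = n * r' + 0 \<or> n * r + x = n * t' + 0 \<or>
        n * t + y = n * r' + 0 \<or> n * t + y = n * t' + 0"
      using meet unfolding 1 2 by auto
    then show ?thesis
      using digits_unique[of n] 1 n by (smt (verit))
  qed
next
  case 1: (axis r t)
  from assms(2) show ?thesis
  proof (cases rule: product_pair_cases)
    case 2: (block x y r' t')
    have "n * r' + x = n * r + 0 \<or> n * r' + x = n * t + 0 \<or>
        n * t' + y = n * r + 0 \<or> n * t' + y = n * t + 0"
      using meet unfolding 1 2 by auto
    then show ?thesis
      using digits_unique[of n] 2 n by (smt (verit))
  next
    case 2: (axis r' t')
    have "{r, t} \<inter> {r', t'} \<noteq> {}"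
      using meet n unfolding 1 2 by auto
    then have "r = r' \<and> t = t'"
      using T' 1(1) 2(1) unfolding ordered_two_partition_def by blast
    then show ?thesis
      unfolding 1 2 by simp
  qed
qed

lemma ordered_two_partition_product:
  "ordered_two_partition (m * n) (product_ordering n X S' T')"
  unfolding ordered_two_partition_def mult.commute[of m n]
proof (intro conjI allI impI ballI subsetI)
  fix p
  assume "p \<in> product_ordering n X S' T'"
  then show "p \<in> Zstar (n * m) \<times> Zstar (n * m)"
    using product_pair_range(1,2) by (cases p) simp
qed (fact product_pair_range(3) product_cover
  product_disjoint[THEN conjunct1] product_disjoint[THEN conjunct2])+

text \<open>All entries already lie strictly between 0 and \<open>n * m\<close>, so the reductions
  change nothing.\<close>

lemma product_pairs_eq_image:
  "product_pairs n m X S' T' = (\<lambda>(a, b). {a, b}) ` product_ordering n X S' T'"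
proof -
  have red: "(n * r + x) mod (n * m) = n * r + x \<and> (n * t + y) mod (n * m) = n * t + y"
    if "(x, y) \<in> S'" "(r, t) \<in> insert (0, 0) X" for x y r t
    using product_pair_range[OF block_mem[OF that]] by (simp add: mem_Zstar)
  have red0: "(n * r) mod (n * m) = n * r \<and> (n * t) mod (n * m) = n * t"
    if "(r, t) \<in> T'" for r t
    using product_pair_range[OF axis_mem[OF that]] by (simp add: mem_Zstar)
  have A: "{{(n * r + x) mod (n * m), (n * t + y) mod (n * m)} | x y r t.
        (x, y) \<in> S' \<and> (r, t) \<in> {(0, 0)} \<union> X} =
      {{n * r + x, n * t + y} | x y r t. (x, y) \<in> S' \<and> (r, t) \<in> insert (0, 0) X}"
    using red by (smt (verit, best) Collect_cong insert_is_Un)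
  have B: "{{(n * r) mod (n * m), (n * t) mod (n * m)} | r t. (r, t) \<in> T'} =
      {{n * r, n * t} | r t. (r, t) \<in> T'}"
    using red0 by (smt (verit, best) Collect_cong)
  show ?thesis
    unfolding product_pairs_def A B product_ordering_def image_Un
    by (intro arg_cong2[where f = "(\<union>)"]) (force simp del: insert_iff)+
qed

section \<open>Sums of product pairs modulo \<open>n\<close> and modulo \<open>m * n\<close>\<close>

text \<open>Within the block of one pair of \<open>S'\<close> the low digits cancel, so the
  difference of two sums is \<open>n\<close> times a difference of nucleus sums.\<close>

lemma block_sum_eq_iff:
  "((n * r + x) + (n * t + y)) mod (m * n) = ((n * r' + x) + (n * t' + y)) mod (m * n) \<longleftrightarrow>
    (r + t) mod m = (r' + t') mod m"
proof -
  have "((n * r + x) + (n * t + y)) - ((n * r' + x) + (n * t' + y)) = ((r + t) - (r' + t')) * n"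
    by (simp add: algebra_simps)
  then show ?thesis
    unfolding mod_eq_dvd_iff using n by (simp only: dvd_mult_cancel_right) simp
qed

lemma axis_sum: "(n * r + n * t) mod (m * n) = n * ((r + t) mod m)"
  by (simp add: mult_mod_right distrib_left mult.commute[of m n])

lemma sum_mod_n: "((n * r + x) + (n * t + y)) mod (m * n) mod n = (x + y) mod n"
proof -
  have "((n * r + x) + (n * t + y)) mod (m * n) mod n = (n * (r + t) + (x + y)) mod n"
    by (simp add: mod_mod_cancel algebra_simps)
  then show ?thesis
    by simp
qed

text \<open>As \<open>n * (r + t)\<close> takes every multiple of \<open>n\<close> modulo \<open>m * n\<close>, each pair of \<open>S'\<close> yields all
  residues modulo \<open>m * n\<close> that agree with its sum modulo \<open>n\<close>.\<close>

lemma block_sum_surj: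
  assumes "skew_nucleus m X" "z mod n = (x + y) mod n"
  obtains r t where "(r, t) \<in> insert (0, 0) X"
    "((n * r + x) + (n * t + y)) mod (m * n) = z mod (m * n)"
proof -
  obtain c where c: "z = (x + y) + n * c"
    using assms(2) by (metis mod_eqE)
  obtain r t where rt: "(r, t) \<in> insert (0, 0) X" "(r + t) mod m = c mod m"
    using skew_nucleus_surj[OF assms(1)] m by (metis order_trans one_le_numeral)
  then have "m dvd (r + t) - c"
    by (simp add: mod_eq_dvd_iff)
  then have "m * n dvd ((r + t) - c) * n"
    by simp
  moreover have "((n * r + x) + (n * t + y)) - z = ((r + t) - c) * n"
    by (simp add: c algebra_simps)
  ultimately have "((n * r + x) + (n * t + y)) mod (m * n) = z mod (m * n)"
    by (simp only: mod_eq_dvd_iff)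
  with rt(1) that show thesis
    by blast
qed

text \<open>This and the next two abbreviations name the pieces of the ordered criteria: strong is
  nonzero and distinct, skew is nonzero and cover. They can thus be transferred one at a
  time.\<close>

abbreviation (input) sums_nonzero :: "int \<Rightarrow> (int \<times> int) set \<Rightarrow> bool" where
  "sums_nonzero k Q \<equiv> (\<forall>x y. (x, y) \<in> Q \<longrightarrow> (x + y) mod k \<noteq> 0)"

abbreviation (input) sums_distinct :: "int \<Rightarrow> (int \<times> int) set \<Rightarrow> bool" where
  "sums_distinct k Q \<equiv> (\<forall>x y x' y'. (x, y) \<in> Q \<longrightarrow> (x', y') \<in> Q \<longrightarrow>
     (x + y) mod k = (x' + y') mod k \<longrightarrow> x = x' \<and> y = y')"

abbreviation (input) sums_cover :: "int \<Rightarrow> (int \<times> int) set \<Rightarrow> bool" where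
  "sums_cover k Q \<equiv>
     (\<forall>z\<in>Zstar k. \<exists>x y. (x, y) \<in> Q \<and> (z = (x + y) mod k \<or> z = - (x + y) mod k))"

section \<open>Transfer of strongness between product and factors\<close>

lemma skew_nucleus_if_product_distinct:
  assumes D: "sums_distinct (m * n) (product_ordering n X S' T')"
  shows "skew_nucleus m X"
proof -
  \<comment> \<open>The residue 1 only serves to show that \<open>S'\<close> has a pair; the block
    of any one pair displays all nucleus sums.\<close>
  have "1 \<in> Zstar n"
    using n by (simp add: mem_Zstar)
  then obtain x y where xy: "(x, y) \<in> S'"
    using S' unfolding ordered_two_partition_def by blast
  have "inj_on (\<lambda>(r, t). (r + t) mod m) (insert (0, 0) X)"
  proof (rule inj_onI, clarify)
    fix r t r' t'
    assume rt: "(r, t) \<in> insert (0, 0) X" "(r', t') \<in> insert (0, 0) X"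
      and "(r + t) mod m = (r' + t') mod m"
    then have "n * r + x = n * r' + x \<and> n * t + y = n * t' + y"
      using D block_mem[OF xy rt(1)] block_mem[OF xy rt(2)] block_sum_eq_iff by blast
    then show "r = r' \<and> t = t'"
      using n by simp
  qed
  then show ?thesis
    using skew_nucleus_iff[OF X] m by simp
qed

text \<open>Since \<open>X\<close> is skew, the block of a pair of \<open>S'\<close> fills a residue
  class modulo \<open>n\<close>. A zero sum in \<open>S'\<close> would put 0 among the product sums,
  and two equal sums in \<open>S'\<close> would make two blocks share a sum. The sums over
  \<open>T'\<close> reappear multiplied by \<open>n\<close>.\<close>

lemma factors_strong_if_product_strong:
  assumes N: "sums_nonzero (m * n) (product_ordering n X S' T')"
    and D: "sums_distinct (m * n) (product_ordering n X S' T')"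
  shows "sums_nonzero n S'" "sums_distinct n S'" "sums_nonzero m T'" "sums_distinct m T'"
proof -
  note sk = skew_nucleus_if_product_distinct[OF D]
  show "sums_nonzero n S'"
  proof (intro allI impI notI)
    fix x y
    assume xy: "(x, y) \<in> S'" "(x + y) mod n = 0"
    then obtain r t where rt: "(r, t) \<in> insert (0, 0) X"
        "((n * r + x) + (n * t + y)) mod (m * n) = 0 mod (m * n)"
      using block_sum_surj[OF sk, of 0 x y] by auto
    then show False
      using N block_mem[OF xy(1) rt(1)] by auto
  qed
  show "sums_distinct n S'"
  proof (intro allI impI)
    fix x y x' y'
    assume xy: "(x, y) \<in> S'" "(x', y') \<in> S'" "(x + y) mod n = (x' + y') mod n"
    then obtain r t where rt: "(r, t) \<in> insert (0, 0) X"
        "((n * r + x') + (n * t + y')) mod (m * n) = (x + y) mod (m * n)"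
      using block_sum_surj[OF sk, of "x + y" x' y'] by auto
    \<comment> \<open>The nucleus pair \<open>(0, 0)\<close> places \<open>(x, y)\<close> itself in
      the product; comparing digits below \<open>n\<close> then identifies it with
      \<open>(x', y')\<close>.\<close>
    have "(x, y) \<in> product_ordering n X S' T'"
      using block_mem[OF xy(1), of 0 0] by simp
    then have eq: "x = n * r + x' \<and> y = n * t + y'"
      using D block_mem[OF xy(2) rt(1)] rt(2) by metis
    have "x \<in> Zstar n" "y \<in> Zstar n" "x' \<in> Zstar n" "y' \<in> Zstar n"
      using S' xy unfolding ordered_two_partition_def by blast+
    then show "x = x' \<and> y = y'"
      using eq digits_unique[of n 0 x r x'] digits_unique[of n 0 y t y'] by (simp add: mem_Zstar)
  qed
  show "sums_nonzero m T'"
    using N axis_mem axis_sum by fastforce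
  show "sums_distinct m T'"
  proof (intro allI impI)
    fix r t r' t'
    assume rt: "(r, t) \<in> T'" "(r', t') \<in> T'" "(r + t) mod m = (r' + t') mod m"
    then have "(n * r + n * t) mod (m * n) = (n * r' + n * t') mod (m * n)"
      by (simp add: axis_sum)
    then have "n * r = n * r' \<and> n * t = n * t'"
      using D axis_mem[OF rt(1)] axis_mem[OF rt(2)] by blast
    then show "r = r' \<and> t = t'"
      using n by simp
  qed
qed

lemma product_sums_nonzero:
  assumes NS: "sums_nonzero n S'" and NT: "sums_nonzero m T'"
  shows "sums_nonzero (m * n) (product_ordering n X S' T')"
proof (intro allI impI)
  fix a b
  assume "(a, b) \<in> product_ordering n X S' T'"
  then show "(a + b) mod (m * n) \<noteq> 0"
  proof (cases rule: product_pair_cases)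
    case (block x y r t)
    then have "(a + b) mod (m * n) mod n \<noteq> 0"
      using NS sum_mod_n by auto
    then show ?thesis
      by auto
  next
    case (axis r t)
    then show ?thesis
      using NT n axis_sum by auto
  qed
qed

text \<open>Modulo \<open>n\<close>, sums of different blocks differ, and none agrees with an axis
  sum, which is 0. Inside a block skewness of \<open>X\<close> separates the sums; on the axis
  \<open>T'\<close> does.\<close>

lemma product_sums_distinct:
  assumes sk: "skew_nucleus m X"
    and NS: "sums_nonzero n S'" and DS: "sums_distinct n S'" and DT: "sums_distinct m T'"
  shows "sums_distinct (m * n) (product_ordering n X S' T')"
proof (intro allI impI)
  fix a b a' b'
  assume ab: "(a, b) \<in> product_ordering n X S' T'" "(a', b') \<in> product_ordering n X S' T'"
    and eq: "(a + b) mod (m * n) = (a' + b') mod (m * n)"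
  then have eqn: "(a + b) mod (m * n) mod n = (a' + b') mod (m * n) mod n"
    by simp
  from ab(1) show "a = a' \<and> b = b'"
  proof (cases rule: product_pair_cases)
    case 1: (block x y r t)
    from ab(2) show ?thesis
    proof (cases rule: product_pair_cases)
      case 2: (block x' y' r' t')
      have "(x + y) mod n = (x' + y') mod n"
        using eqn unfolding 1 2 sum_mod_n .
      then have xy: "x' = x" "y' = y"
        using DS 1(1) 2(1) by blast+
      have "(r + t) mod m = (r' + t') mod m"
        using eq unfolding 1 2 xy block_sum_eq_iff .
      moreover have inj: "inj_on (\<lambda>(r, t). (r + t) mod m) (insert (0, 0) X)"
        using sk skew_nucleus_iff[OF X] m by simp
      ultimately have "(r, t) = (r', t')"
        using inj_onD[OF inj _ 1(2) 2(2)] by simp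
      then show ?thesis
        unfolding 1 2 xy by simp
    next
      case 2: (axis r' t')
      have "(x + y) mod n = 0"
        using eqn unfolding 1 2 sum_mod_n axis_sum by simp
      then show ?thesis
        using NS 1(1) by metis
    qed
  next
    case 1: (axis r t)
    from ab(2) show ?thesis
    proof (cases rule: product_pair_cases)
      case 2: (block x' y' r' t')
      have "(x' + y') mod n = 0"
        using eqn unfolding 1 2 sum_mod_n axis_sum by simp
      then show ?thesis
        using NS 2(1) by metis
    next
      case 2: (axis r' t')
      have "(r + t) mod m = (r' + t') mod m"
        using eq n unfolding 1 2 axis_sum by simp
      then have "r = r' \<and> t = t'"
        using DT 1(1) 2(1) by blast
      then show ?thesis
        unfolding 1 2 by simp
    qed
  qed
qed

section \<open>Transfer of covering by sums and their negatives\<close>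

text \<open>Residues \<open>z < n\<close> test \<open>S'\<close>: they are nonzero modulo
  \<open>n\<close>, so only blocks reach them. Multiples \<open>n * z\<close> test
  \<open>T'\<close>: since no sum over \<open>S'\<close> vanishes modulo \<open>n\<close>, only axis
  pairs reach them.\<close>

lemma factors_cover_if_product_cover:
  assumes C: "sums_cover (m * n) (product_ordering n X S' T')" and NS: "sums_nonzero n S'"
  shows "sums_cover n S'" "sums_cover m T'"
proof -
  \<comment> \<open>\<open>sum_mod_n\<close> holds for arbitrary integers, so negating every digit
    transfers it to negated sums.\<close>
  have neg_mod_n: "(- ((n * r + x) + (n * t + y))) mod (m * n) mod n = - (x + y) mod n" for r x t y
    using sum_mod_n[of "- r" "- x" "- t" "- y"] by (simp add: algebra_simps)
  have neg_axis: "(- (n * r + n * t)) mod (m * n) = n * (- (r + t) mod m)" for r t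
    using axis_sum[of "- r" "- t"] by (simp add: algebra_simps)
  show "sums_cover n S'"
  proof
    fix z
    assume z: "z \<in> Zstar n"
    have "1 * n \<le> m * n"
      using n m by (intro mult_right_mono) auto
    then have "z \<in> Zstar (m * n)"
      using z unfolding mem_Zstar by linarith
    then obtain a b where ab: "(a, b) \<in> product_ordering n X S' T'"
        "z = (a + b) mod (m * n) \<or> z = - (a + b) mod (m * n)"
      using C by blast
    have zn: "z mod n = z" "z \<noteq> 0"
      using z by (auto simp: mem_Zstar)
    from ab(1) show "\<exists>x y. (x, y) \<in> S' \<and> (z = (x + y) mod n \<or> z = - (x + y) mod n)"
    proof (cases rule: product_pair_cases)
      case (block x y r t)
      have "z mod n = (x + y) mod n \<or> z mod n = - (x + y) mod n"
        using ab(2) sum_mod_n neg_mod_n unfolding block by metis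
      then show ?thesis
        using block(1) zn by auto
    next
      case (axis r t)
      have "z mod n = 0"
        using ab(2) unfolding axis axis_sum neg_axis by auto
      then show ?thesis
        using zn by simp
    qed
  qed
  show "sums_cover m T'"
  proof
    fix z
    assume "z \<in> Zstar m"
    then have "n * z \<in> Zstar (m * n)"
      using n by (simp add: mem_Zstar mult.commute)
    then obtain a b where ab: "(a, b) \<in> product_ordering n X S' T'"
        "n * z = (a + b) mod (m * n) \<or> n * z = - (a + b) mod (m * n)"
      using C by blast
    from ab(1) show "\<exists>x y. (x, y) \<in> T' \<and> (z = (x + y) mod m \<or> z = - (x + y) mod m)"
    proof (cases rule: product_pair_cases)
      case (block x y r t)
      have "(n * z) mod n = (x + y) mod n \<or> (n * z) mod n = - (x + y) mod n"
        using ab(2) sum_mod_n neg_mod_n unfolding block by metis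
      then have "(x + y) mod n = 0"
        by (metis dvd_eq_mod_eq_0 dvd_minus_iff mod_mult_self1_is_0)
      then show ?thesis
        using NS block(1) by metis
    next
      case (axis r t)
      have "n * z = n * ((r + t) mod m) \<or> n * z = n * (- (r + t) mod m)"
        using ab(2) unfolding axis axis_sum neg_axis .
      then have "z = (r + t) mod m \<or> z = - (r + t) mod m"
        using n by (simp del: minus_add_distrib)
      then show ?thesis
        using axis(1) by blast
    qed
  qed
qed

text \<open>Axis pairs reach the multiples of \<open>n\<close>; every other residue lies in a class
  that is filled, up to sign, by the block of a pair of \<open>S'\<close>.\<close>

lemma product_sums_cover:
  assumes sk: "skew_nucleus m X" and CS: "sums_cover n S'" and CT: "sums_cover m T'"
  shows "sums_cover (m * n) (product_ordering n X S' T')"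
proof
  fix z
  assume z: "z \<in> Zstar (m * n)"
  then have zz: "z mod (m * n) = z"
    by (simp add: mem_Zstar)
  show "\<exists>a b. (a, b) \<in> product_ordering n X S' T' \<and>
      (z = (a + b) mod (m * n) \<or> z = - (a + b) mod (m * n))"
  proof (cases "z mod n = 0")
    case True
    then obtain w where w: "z = n * w"
      by auto
    then have "w \<in> Zstar m"
      using z n by (simp add: mem_Zstar mult.commute zero_less_mult_iff)
    then obtain r t where rt: "(r, t) \<in> T'" "w = (r + t) mod m \<or> w = - (r + t) mod m"
      using CT by blast
    have "- (n * r + n * t) mod (m * n) = n * (- (r + t) mod m)"
      using axis_sum[of "- r" "- t"] by (simp add: algebra_simps)
    then have "z = (n * r + n * t) mod (m * n) \<or> z = - (n * r + n * t) mod (m * n)"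
      using rt(2) w axis_sum by metis
    then show ?thesis
      using axis_mem[OF rt(1)] by blast
  next
    case False
    then have "z mod n \<in> Zstar n"
      using n by (simp add: mod_mem_Zstar)
    then obtain x y where xy: "(x, y) \<in> S'" "z mod n = (x + y) mod n \<or> z mod n = - (x + y) mod n"
      using CS by blast
    from xy(2) show ?thesis
    proof
      assume "z mod n = (x + y) mod n"
      from block_sum_surj[OF sk this] obtain r t where
        rt: "(r, t) \<in> insert (0, 0) X" "((n * r + x) + (n * t + y)) mod (m * n) = z mod (m * n)" .
      then show ?thesis
        using block_mem[OF xy(1) rt(1)] zz by metis
    next
      \<comment> \<open>Here the block is made to hit \<open>- z\<close>, and its sum is negated at
        the end.\<close>
      assume "z mod n = - (x + y) mod n"
      then have "(- z) mod n = (x + y) mod n"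
        by (metis mod_minus_cong minus_minus)
      from block_sum_surj[OF sk this] obtain r t where
        rt: "(r, t) \<in> insert (0, 0) X" "((n * r + x) + (n * t + y)) mod (m * n) = (- z) mod (m * n)" .
      then have "- ((n * r + x) + (n * t + y)) mod (m * n) = z"
        using zz by (metis mod_minus_cong minus_minus)
      then show ?thesis
        using block_mem[OF xy(1) rt(1)] by metis
    qed
  qed
qed

end

section \<open>Assembly of both equivalences\<close>

theorem theorem3p18:
  fixes n m :: int
    and S T W :: "int set set"
    and X :: "(int \<times> int) set"
  assumes "n \<ge> 3" and "odd n"
    and "m \<ge> 3" and "odd m"
    and "two_partition n S" and "two_partition m T"
    and "nucleus m X"
    and "generated_product n m X S T W"
  shows "(strong_two_partition (m * n) W \<longleftrightarrow>
            skew_nucleus m X \<and> strong_two_partition n S \<and> strong_two_partition m T) \<and>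
         (skew_two_partition (m * n) W \<longleftrightarrow>
            skew_nucleus m X \<and> skew_two_partition n S \<and> skew_two_partition m T)"
proof -
  note S = \<open>two_partition n S\<close> and T = \<open>two_partition m T\<close>
  obtain S' T' where S': "ordering_of S S'" and T': "ordering_of T T'"
    and W: "W = product_pairs n m X S' T'"
    using assms unfolding generated_product_def by blast
  note ctxt = \<open>n \<ge> 3\<close> \<open>m \<ge> 3\<close> \<open>nucleus m X\<close>
    ordered_two_partition_of_ordering[OF S S'] ordered_two_partition_of_ordering[OF T T']
  define Q where "Q = product_ordering n X S' T'"
  have "ordered_two_partition (m * n) Q" "W = (\<lambda>(x, y). {x, y}) ` Q"
    unfolding Q_def W
    by (fact ordered_two_partition_product[OF ctxt] product_pairs_eq_image[OF ctxt])+
  then have P: "two_partition (m * n) W" and O: "ordering_of W Q"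
    using two_partition_of_ordered ordering_of_ordered by blast+
  have pos: "n > 0" "m > 0" "m * n > 0"
    using assms by auto
  note strong_W = strong_two_partition_iff_ordered[OF P O, unfolded Q_def]
  note strong_S = strong_two_partition_iff_ordered[OF S S']
  note strong_T = strong_two_partition_iff_ordered[OF T T']
  note skew_W = skew_two_partition_iff_ordered[OF P O pos(3), unfolded Q_def]
  note skew_S = skew_two_partition_iff_ordered[OF S S' pos(1)]
  note skew_T = skew_two_partition_iff_ordered[OF T T' pos(2)]
  have strong: "strong_two_partition (m * n) W \<longleftrightarrow>
      skew_nucleus m X \<and> strong_two_partition n S \<and> strong_two_partition m T" (is "?L \<longleftrightarrow> ?R")
  proof
    assume ?L
    then show ?R
      unfolding strong_W strong_S strong_T
      using skew_nucleus_if_product_distinct[OF ctxt] factors_strong_if_product_strong[OF ctxt]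
      by (elim conjE) (intro conjI; assumption?; blast)
  next
    assume ?R
    then show ?L
      unfolding strong_W strong_S strong_T
      by (elim conjE) (intro conjI product_sums_nonzero[OF ctxt] product_sums_distinct[OF ctxt])
  qed
  have "skew_two_partition (m * n) W \<longleftrightarrow>
      skew_nucleus m X \<and> skew_two_partition n S \<and> skew_two_partition m T" (is "?L \<longleftrightarrow> ?R")
  proof
    assume L: ?L
    \<comment> \<open>By counting, a skew product is strong, so the first equivalence yields
      skewness of \<open>X\<close> and nonzero sums in both factors; only covering remains to be
      transferred.\<close>
    then have R: "skew_nucleus m X" "strong_two_partition n S" "strong_two_partition m T"
      using strong strong_if_skew_two_partition[OF L] pos by auto
    then show ?R
      using L factors_cover_if_product_cover[OF ctxt]
      unfolding skew_W skew_S skew_T strong_S strong_T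
      by (elim conjE) (intro conjI; assumption)
  next
    assume ?R
    then show ?L
      unfolding skew_W skew_S skew_T
      by (elim conjE) (intro conjI product_sums_nonzero[OF ctxt] product_sums_cover[OF ctxt])
  qed
  with strong show ?thesis
    by blast
qed

end
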